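(* Let $n,M\ge 1$, $\mathbf{Y}\in\mathbb{R}^n$, $\mathbf{f}_1,\dots,\mathbf{f}_M\in\mathbb{R}^n$, $\boldsymbol{\pi}\in\Lambda^M$, $\nu\in(0,1)$ and $\omega>0$. Let $Q$, $T$, $S$, $A$, $B$ be as defined in the context, and let $\boldsymbol{\lambda}^Q\in\operatorname*{argmin}_{\boldsymbol{\lambda}\in\Lambda^M}Q(\boldsymbol{\lambda})$ and $\hat{\mathbf{h}}=\operatorname*{argmax}_{\mathbf{h}\in\mathbb{R}^n}T(\mathbf{h})$. Then for every $\boldsymbol{\lambda}\in\Lambda^M$ and every $\mathbf{h}\in\mathbb{R}^n$, $$Q(\boldsymbol{\lambda})=\max_{\mathbf{h}'\in\mathbb{R}^n}S(\boldsymbol{\lambda},\mathbf{h}'),\qquad T(\mathbf{h})=\min_{\boldsymbol{\lambda}'\in\Lambda^M}S(\boldsymbol{\lambda}',\mathbf{h}),$$ and $$\min_{\boldsymbol{\lambda}\in\Lambda^M}Q(\boldsymbol{\lambda})=\min_{\boldsymbol{\lambda}\in\Lambda^M}\max_{\mathbf{h}\in\mathbb{R}^n}S(\boldsymbol{\lambda},\mathbf{h})=\max_{\mathbf{h}\in\mathbb{R}^n}\min_{\boldsymbol{\lambda}\in\Lambda^M}S(\boldsymbol{\lambda},\mathbf{h})=\max_{\mathbf{h}\in\mathbb{R}^n}T(\mathbf{h}),$$ where the common value is achieved at $(\boldsymbol{\lambda}^Q,\hat{\mathbf{h}})$. Moreover, $\{(\boldsymbol{\lambda}^Q,\hat{\mathbf{h}})\}=A\cap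 B$.
   Context: $\Lambda^M=\{\boldsymbol{\lambda}\in\mathbb{R}^M:\lambda_j\ge 0,\ \sum_{j=1}^M\lambda_j=1\}$. For $\boldsymbol{\lambda}\in\Lambda^M$, $\mathbf{f}_{\boldsymbol{\lambda}}=\sum_{j=1}^M\lambda_j\mathbf{f}_j$. The Kullback-Leibler divergence is $\mathcal{K}(\boldsymbol{\lambda},\boldsymbol{\pi})=\sum_{j=1}^M\lambda_j\log(\lambda_j/\pi_j)$, with the conventions that a term with $\lambda_j=0$ equals $0$ and a term with $\lambda_j>0$, $\pi_j=0$ equals $+\infty$. Definitions, for $\boldsymbol{\lambda}\in\Lambda^M$ and $\mathbf{h}\in\mathbb{R}^n$: $$Q(\boldsymbol{\lambda})=\|\mathbf{f}_{\boldsymbol{\lambda}}-\mathbf{Y}\|_2^2+\nu\sum_{j=1}^M\lambda_j\|\mathbf{f}_j-\mathbf{f}_{\boldsymbol{\lambda}}\|_2^2+2\omega^2\mathcal{K}(\boldsymbol{\lambda},\boldsymbol{\pi}),$$ $$T(\mathbf{h})=-\frac{\nu}{1-\nu}\|\mathbf{h}-\mathbf{Y}\|_2^2-2\omega^2\log\left(\sum_{j=1}^M\pi_j\exp\left(-\frac{\nu}{2\omega^2}\|\mathbf{f}_j-\mathbf{h}\|_2^2\right)\right),$$ $$S(\boldsymbol{\lambda},\mathbf{h})=-\frac{\nu}{1-\nu}\|\mathbf{h}-\mathbf{Y}\|_2^2+\nu\sum_{j=1}^M\lambda_j\|\mathbf{f}_j-\mathbf{h}\|_2^2+2\omega^2\mathcal{K}(\boldsymbol{\lambda},\boldsymbol{\pi}),$$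 $$A=\left\{(\boldsymbol{\lambda},\mathbf{h})\in\Lambda^M\times\mathbb{R}^n:\ \mathbf{h}=\frac1\nu\mathbf{Y}-\frac{1-\nu}{\nu}\mathbf{f}_{\boldsymbol{\lambda}}\right\},$$ $$B=\left\{(\boldsymbol{\lambda},\mathbf{h})\in\Lambda^M\times\mathbb{R}^n:\ \lambda_j=\frac{\exp\left(-\frac{\nu}{2\omega^2}\|\mathbf{f}_j-\mathbf{h}\|_2^2\right)\pi_j}{\sum_{i=1}^M\exp\left(-\frac{\nu}{2\omega^2}\|\mathbf{f}_i-\mathbf{h}\|_2^2\right)\pi_i}\ \text{ for all } j=1,\dots,M\right\}.$$ *)

theory Defs
  imports "HOL-Analysis.Analysis"
begin

definition attains_min :: "('a \<Rightarrow> 'b::linorder) \<Rightarrow> 'a set \<Rightarrow> 'b \<Rightarrow> bool" where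
  "attains_min g X v \<longleftrightarrow> (\<exists>x\<in>X. g x = v) \<and> (\<forall>x\<in>X. v \<le> g x)"

definition attains_max :: "('a \<Rightarrow> 'b::linorder) \<Rightarrow> 'a set \<Rightarrow> 'b \<Rightarrow> bool" where
  "attains_max g X v \<longleftrightarrow> (\<exists>x\<in>X. g x = v) \<and> (\<forall>x\<in>X. g x \<le> v)"

definition prob_simplex :: "(real ^ 'm::finite) set" where
  "prob_simplex = {l. (\<forall>j. 0 \<le> l $ j) \<and> (\<Sum>j\<in>UNIV. l $ j) = 1}"

definition mixture :: "('m::finite \<Rightarrow> real ^ 'n::finite) \<Rightarrow> real ^ 'm \<Rightarrow> real ^ 'n" where
  "mixture f l = (\<Sum>j\<in>UNIV. (l $ j) *\<^sub>R f j)"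

(* The weights in p may vanish, so the divergence is extended-real valued.  No summand is
   -\<infinity>, hence the ereal sum is \<infinity> exactly if some summand is. *)
definition KL :: "real ^ 'm::finite \<Rightarrow> real ^ 'm \<Rightarrow> ereal" where
  "KL l p = (\<Sum>j\<in>UNIV. if l $ j = 0 then 0
                        else if p $ j = 0 then \<infinity>
                        else ereal (l $ j * ln (l $ j / p $ j)))"

definition Q_fun ::
  "real \<Rightarrow> real \<Rightarrow> real ^ 'm \<Rightarrow> ('m::finite \<Rightarrow> real ^ 'n::finite) \<Rightarrow> real ^ 'n \<Rightarrow> real ^ 'm \<Rightarrow> ereal" where
  "Q_fun \<nu> \<omega> p f Y l =
     ereal ((norm (mixture f l - Y))\<^sup>2
            + \<nu> * (\<Sum>j\<in>UNIV. l $ j * (norm (f j - mixture f l))\<^sup>2))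
     + ereal (2 * \<omega>\<^sup>2) * KL l p"

definition T_fun ::
  "real \<Rightarrow> real \<Rightarrow> real ^ 'm \<Rightarrow> ('m::finite \<Rightarrow> real ^ 'n::finite) \<Rightarrow> real ^ 'n \<Rightarrow> real ^ 'n \<Rightarrow> real" where
  "T_fun \<nu> \<omega> p f Y h =
     - (\<nu> / (1 - \<nu>)) * (norm (h - Y))\<^sup>2
     - 2 * \<omega>\<^sup>2 * ln (\<Sum>j\<in>UNIV. p $ j * exp (- (\<nu> / (2 * \<omega>\<^sup>2)) * (norm (f j - h))\<^sup>2))"

definition S_fun ::
  "real \<Rightarrow> real \<Rightarrow> real ^ 'm \<Rightarrow> ('m::finite \<Rightarrow> real ^ 'n::finite) \<Rightarrow> real ^ 'n
     \<Rightarrow> real ^ 'm \<Rightarrow> real ^ 'n \<Rightarrow> ereal" where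
  "S_fun \<nu> \<omega> p f Y l h =
     ereal (- (\<nu> / (1 - \<nu>)) * (norm (h - Y))\<^sup>2
            + \<nu> * (\<Sum>j\<in>UNIV. l $ j * (norm (f j - h))\<^sup>2))
     + ereal (2 * \<omega>\<^sup>2) * KL l p"

definition A_set ::
  "real \<Rightarrow> ('m::finite \<Rightarrow> real ^ 'n::finite) \<Rightarrow> real ^ 'n \<Rightarrow> ((real ^ 'm) \<times> (real ^ 'n)) set" where
  "A_set \<nu> f Y =
     {(l, h). l \<in> prob_simplex \<and> h = (1 / \<nu>) *\<^sub>R Y - ((1 - \<nu>) / \<nu>) *\<^sub>R mixture f l}"

definition B_set ::
  "real \<Rightarrow> real \<Rightarrow> real ^ 'm \<Rightarrow> ('m::finite \<Rightarrow> real ^ 'n::finite) \<Rightarrow> ((real ^ 'm) \<times> (real ^ 'n)) set" where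
  "B_set \<nu> \<omega> p f =
     {(l, h). l \<in> prob_simplex \<and>
        (\<forall>j. l $ j = exp (- (\<nu> / (2 * \<omega>\<^sup>2)) * (norm (f j - h))\<^sup>2) * p $ j
                     / (\<Sum>i\<in>UNIV. exp (- (\<nu> / (2 * \<omega>\<^sup>2)) * (norm (f i - h))\<^sup>2) * p $ i))}"

end

theory Submission
  imports Defs
begin

text \<open>
  Completing the square gives \<open>S(l, h) = Q(l) - \<nu>\<^sup>2/(1 - \<nu>) \<parallel>h - h\<^sub>l\<parallel>\<^sup>2\<close> with \<open>(l, h\<^sub>l) \<in> A\<close>, and
  rewriting the divergence gives \<open>S(l, h) = T(h) + 2\<omega>\<^sup>2 K(l, g\<^sub>h)\<close> with \<open>(g\<^sub>h, h) \<in> B\<close>.  Both remainders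
  are nonnegative and vanish only on \<open>A\<close> and on \<open>B\<close> respectively, so every point of \<open>A \<inter> B\<close> is a
  saddle point and coincides with \<open>(l\<^sup>Q, h)\<close> for any minimiser \<open>l\<^sup>Q\<close> of \<open>Q\<close> and maximiser \<open>h\<close> of \<open>T\<close>.
  Such a point exists by Brouwer's theorem, applied to \<open>l \<mapsto> g(h\<^sub>l)\<close> on the simplex.
\<close>

section \<open>The Kullback-Leibler divergence\<close>

lemma KL_abs_cont:
  assumes "\<And>j. p $ j = 0 \<Longrightarrow> l $ j = 0"
  shows "KL l p = ereal (\<Sum>j\<in>UNIV. l $ j * ln (l $ j / p $ j))"
proof -
  have "KL l p = (\<Sum>j\<in>UNIV. ereal (l $ j * ln (l $ j / p $ j)))"
    unfolding KL_def using assms by (intro sum.cong) auto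
  then show ?thesis by simp
qed

lemma KL_not_abs_cont:
  assumes "p $ i = 0" "l $ i \<noteq> 0"
  shows "KL l p = \<infinity>"
  unfolding KL_def using assms by (auto simp: sum_Pinfty)

text \<open>For nonzero \<open>l\<close> the expression is \<open>l\<close> times
  \<open>t - 1 - ln t\<close> at \<open>t = q / l\<close>, which is nonnegative and zero only at
  \<open>t = 1\<close>. The corrections \<open>- l + q\<close> cancel when summed over two
  probability vectors, so the divergence can be treated termwise.\<close>

lemma KL_term_lower:
  fixes l q :: real
  assumes "0 \<le> l" "0 \<le> q" "q = 0 \<Longrightarrow> l = 0"
  shows "0 \<le> l * ln (l / q) - l + q"
    and "l * ln (l / q) - l + q = 0 \<Longrightarrow> l = q"
proof -
  have pos: "0 \<le> l * ln (l / q) - l + q \<and> (l * ln (l / q) - l + q = 0 \<longrightarrow> l = q)"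
  proof (cases "l = 0")
    case False
    with assms have "l > 0" "q > 0" by (auto simp: less_le)
    have eq: "l * ln (l / q) - l + q = l * ((q / l - 1) - ln (q / l))"
      using \<open>l > 0\<close> \<open>q > 0\<close> by (simp add: ln_div field_simps)
    have "ln (q / l) \<le> q / l - 1"
      using \<open>l > 0\<close> \<open>q > 0\<close> by (intro ln_le_minus_one) simp
    moreover have "q / l = 1" if "ln (q / l) = q / l - 1"
      using that \<open>l > 0\<close> \<open>q > 0\<close> by (intro ln_eq_minus_one) auto
    ultimately show ?thesis
      unfolding eq using \<open>l > 0\<close> by auto
  qed (use assms in auto)
  then show "0 \<le> l * ln (l / q) - l + q"
    and "l * ln (l / q) - l + q = 0 \<Longrightarrow> l = q" by auto
qed

lemma KL_nonneg_and_zero: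
  assumes l: "l \<in> prob_simplex" and q: "q \<in> prob_simplex"
  shows "0 \<le> KL l q \<and> (KL l q = 0 \<longleftrightarrow> l = q)"
proof (cases "\<forall>j. q $ j = 0 \<longrightarrow> l $ j = 0")
  case True
  let ?d = "\<lambda>j. l $ j * ln (l $ j / q $ j) - l $ j + q $ j"
  have nonneg: "0 \<le> l $ j" "0 \<le> q $ j" for j
    using l q by (auto simp: prob_simplex_def)
  have summand: "0 \<le> ?d j" "?d j = 0 \<Longrightarrow> l $ j = q $ j" for j
    using KL_term_lower[OF nonneg(1)[of j] nonneg(2)[of j]] True by auto
  have KL: "KL l q = ereal (\<Sum>j\<in>UNIV. ?d j)"
    using l q True by (simp add: KL_abs_cont sum.distrib sum_subtractf prob_simplex_def)
  have "l = q" if "(\<Sum>j\<in>UNIV. ?d j) = 0"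
    using that summand by (subst (asm) sum_nonneg_eq_0_iff) (auto simp: vec_eq_iff)
  moreover have "(\<Sum>j\<in>UNIV. ?d j) = 0" if "l = q"
  proof (intro sum.neutral ballI)
    show "?d j = 0" for j
      using that by (cases "l $ j = 0") auto
  qed
  ultimately show ?thesis
    unfolding KL using summand(1) by (auto intro: sum_nonneg simp: zero_ereal_def)
next
  case False
  then obtain i where "q $ i = 0" "l $ i \<noteq> 0" by auto
  then show ?thesis using KL_not_abs_cont by fastforce
qed

section \<open>Compactness and convexity of the simplex\<close>

lemma compact_prob_simplex: "compact (prob_simplex :: (real ^ 'm::finite) set)"
proof -
  have "l $ i \<le> 1" if "\<forall>j. 0 \<le> l $ j" "(\<Sum>j\<in>UNIV. l $ j) = 1" for l :: "real ^ 'm" and i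
    using member_le_sum[of i UNIV "\<lambda>j. l $ j"] that by auto
  then have "prob_simplex = cbox 0 1 \<inter> {l :: real ^ 'm. (\<Sum>j\<in>UNIV. l $ j) = 1}"
    by (auto simp: prob_simplex_def mem_box_cart)
  moreover have "closed {l :: real ^ 'm. (\<Sum>j\<in>UNIV. l $ j) = 1}"
    by (intro closed_Collect_eq continuous_intros)
  ultimately show ?thesis
    by (metis compact_Int_closed compact_cbox)
qed

lemma convex_prob_simplex: "convex prob_simplex"
proof (rule convexI)
  fix x y :: "real ^ 'm" and u v :: real
  assume "x \<in> prob_simplex" "y \<in> prob_simplex" "0 \<le> u" "0 \<le> v" "u + v = 1"
  then show "u *\<^sub>R x + v *\<^sub>R y \<in> prob_simplex"
    by (simp add: prob_simplex_def sum.distrib flip: sum_distrib_left)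
qed

section \<open>Completing the square in \<open>h\<close>\<close>

lemma sum_weighted_sq_dist:
  assumes "l \<in> prob_simplex"
  shows "(\<Sum>j\<in>UNIV. l $ j * (norm (f j - h))\<^sup>2)
    = (\<Sum>j\<in>UNIV. l $ j * (norm (f j - mixture f l))\<^sup>2) + (norm (mixture f l - h))\<^sup>2"
proof -
  let ?m = "mixture f l"
  have one: "(\<Sum>j\<in>UNIV. l $ j) = 1"
    using assms by (simp add: prob_simplex_def)
  have summand: "l $ j * (norm (f j - h))\<^sup>2 = l $ j * (norm (f j - ?m))\<^sup>2
      + l $ j * (norm (?m - h))\<^sup>2 + 2 * ((l $ j *\<^sub>R f j - l $ j *\<^sub>R ?m) \<bullet> (?m - h))" for j
    unfolding power2_norm_eq_inner
    by (simp add: inner_diff_left inner_diff_right inner_commute algebra_simps)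
  \<comment> \<open>Weighted deviations from the mean sum to zero, which removes the cross
    term.\<close>
  have "(\<Sum>j\<in>UNIV. l $ j *\<^sub>R f j - l $ j *\<^sub>R ?m) = 0"
    by (simp add: sum_subtractf one mixture_def flip: scaleR_left.sum)
  then have "(\<Sum>j\<in>UNIV. (l $ j *\<^sub>R f j - l $ j *\<^sub>R ?m) \<bullet> (?m - h)) = 0"
    by (simp flip: inner_sum_left)
  then show ?thesis
    unfolding summand by (simp add: sum.distrib one flip: sum_distrib_left sum_distrib_right)
qed

text \<open>For \<open>l\<close> in the simplex this maximises \<open>S_fun\<close> in
  \<open>h\<close>, uniquely when \<open>KL l p\<close> is finite.\<close>

definition best_h :: "real \<Rightarrow> ('m::finite \<Rightarrow> real ^ 'n::finite) \<Rightarrow> real ^ 'n \<Rightarrow> real ^ 'm \<Rightarrow> real ^ 'n" where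
  "best_h \<nu> f Y l = (1 / \<nu>) *\<^sub>R Y - ((1 - \<nu>) / \<nu>) *\<^sub>R mixture f l"

text \<open>The Gibbs measure with prior \<open>p\<close>, squared distances to \<open>h\<close> as
  energies and inverse temperature \<open>\<nu> / (2 * \<omega>\<^sup>2)\<close>.\<close>

definition gibbs ::
  "real \<Rightarrow> real \<Rightarrow> real ^ 'm \<Rightarrow> ('m::finite \<Rightarrow> real ^ 'n::finite) \<Rightarrow> real ^ 'n \<Rightarrow> real ^ 'm" where
  "gibbs \<nu> \<omega> p f h =
     (\<chi> j. exp (- (\<nu> / (2 * \<omega>\<^sup>2)) * (norm (f j - h))\<^sup>2) * p $ j
           / (\<Sum>i\<in>UNIV. exp (- (\<nu> / (2 * \<omega>\<^sup>2)) * (norm (f i - h))\<^sup>2) * p $ i))"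

lemma Q_eq_S_plus_square:
  assumes "l \<in> prob_simplex" "0 < \<nu>" "\<nu> < 1"
  shows "Q_fun \<nu> \<omega> p f Y l
    = S_fun \<nu> \<omega> p f Y l h + ereal (\<nu>\<^sup>2 / (1 - \<nu>) * (norm (h - best_h \<nu> f Y l))\<^sup>2)"
proof -
  define u w where "u = mixture f l - Y" and "w = h - Y"
  have 1: "mixture f l - h = u - w" by (simp add: u_def w_def)
  have 2: "h - best_h \<nu> f Y l = w + ((1 - \<nu>) / \<nu>) *\<^sub>R u"
    using assms by (simp add: u_def w_def best_h_def diff_divide_distrib algebra_simps)
  \<comment> \<open>The coefficient of the squared norm of \<open>h\<close> in \<open>S_fun\<close>
    is \<open>- c\<close>; matching the mixed term then forces the shift \<open>k\<close>.\<close>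
  define k c where "k = (1 - \<nu>) / \<nu>" and "c = \<nu>\<^sup>2 / (1 - \<nu>)"
  have coeffs: "c = \<nu> / (1 - \<nu>) - \<nu>" "c * k = \<nu>" "c * k\<^sup>2 = 1 - \<nu>"
    using assms by (simp_all add: k_def c_def field_simps power2_eq_square)
  have "c * (norm (w + k *\<^sub>R u))\<^sup>2 = c * (w \<bullet> w) + 2 * (c * k) * (u \<bullet> w) + (c * k\<^sup>2) * (u \<bullet> u)"
    unfolding power2_norm_eq_inner
    by (simp add: inner_add_left inner_add_right inner_commute[of w u] algebra_simps power2_eq_square)
  then have "(norm u)\<^sup>2 = - (\<nu> / (1 - \<nu>)) * (norm w)\<^sup>2 + \<nu> * (norm (u - w))\<^sup>2
      + c * (norm (w + k *\<^sub>R u))\<^sup>2"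
    \<comment> \<open>\<open>coeffs(1)\<close> rewrites \<open>c\<close> itself, so the products
      with \<open>k\<close> are replaced first.\<close>
    unfolding coeffs(2,3) power2_norm_eq_inner unfolding coeffs(1)
    by (simp add: inner_diff_left inner_diff_right inner_commute[of w u] algebra_simps)
  then have "(norm (mixture f l - Y))\<^sup>2 + \<nu> * (\<Sum>j\<in>UNIV. l $ j * (norm (f j - mixture f l))\<^sup>2)
      = - (\<nu> / (1 - \<nu>)) * (norm (h - Y))\<^sup>2 + \<nu> * (\<Sum>j\<in>UNIV. l $ j * (norm (f j - h))\<^sup>2)
        + \<nu>\<^sup>2 / (1 - \<nu>) * (norm (h - best_h \<nu> f Y l))\<^sup>2"
    unfolding 2 sum_weighted_sq_dist[OF assms(1), of f h] 1
    by (simp add: u_def w_def k_def c_def distrib_left)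
  then show ?thesis
    \<comment> \<open>The divergence is only moved by associativity and commutativity, so it may be
      infinite.\<close>
    unfolding Q_fun_def S_fun_def by (simp only: plus_ereal.simps[symmetric] ac_simps)
qed

section \<open>Gibbs weights and the dual objective\<close>

lemma prob_simplex_weighted_sum_pos:
  assumes "p \<in> prob_simplex" "\<And>j. 0 < w j"
  shows "0 < (\<Sum>j\<in>UNIV. w j * p $ j)"
proof -
  have nonneg: "0 \<le> w j * p $ j" for j
    using assms by (simp add: prob_simplex_def less_imp_le)
  have "\<exists>j. p $ j \<noteq> 0"
    using assms(1) by (auto simp: prob_simplex_def intro: ccontr)
  then obtain j where "p $ j \<noteq> 0" ..
  with assms(1) have "0 < p $ j" by (simp add: prob_simplex_def less_le)
  then show ?thesis
    using assms(2) nonneg by (intro sum_pos2[of UNIV j]) auto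
qed

lemma gibbs_in_prob_simplex:
  assumes "p \<in> prob_simplex"
  shows "gibbs \<nu> \<omega> p f h \<in> prob_simplex"
proof -
  let ?w = "\<lambda>j. exp (- (\<nu> / (2 * \<omega>\<^sup>2)) * (norm (f j - h))\<^sup>2)"
  have Z: "0 < (\<Sum>j\<in>UNIV. ?w j * p $ j)"
    using assms by (rule prob_simplex_weighted_sum_pos) simp
  have "0 \<le> gibbs \<nu> \<omega> p f h $ j" for j
    using assms Z by (simp add: gibbs_def prob_simplex_def)
  then show ?thesis
    using Z by (simp add: prob_simplex_def gibbs_def flip: sum_divide_distrib)
qed

text \<open>This is the Gibbs variational principle: the logarithm of the Gibbs weight splits the
  divergence from \<open>gibbs\<close> into the divergence from \<open>p\<close>, the mean energy
  and the log normaliser.\<close>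

lemma S_eq_T_plus_KL:
  assumes l: "l \<in> prob_simplex" and p: "p \<in> prob_simplex" and "0 < \<omega>"
  shows "S_fun \<nu> \<omega> p f Y l h
    = ereal (T_fun \<nu> \<omega> p f Y h) + ereal (2 * \<omega>\<^sup>2) * KL l (gibbs \<nu> \<omega> p f h)"
proof -
  let ?a = "\<lambda>j. \<nu> / (2 * \<omega>\<^sup>2) * (norm (f j - h))\<^sup>2"
  define Z where "Z = (\<Sum>j\<in>UNIV. exp (- (\<nu> / (2 * \<omega>\<^sup>2)) * (norm (f j - h))\<^sup>2) * p $ j)"
  have Z: "0 < Z"
    unfolding Z_def using p by (rule prob_simplex_weighted_sum_pos) simp
  have gibbs: "gibbs \<nu> \<omega> p f h $ j = exp (- ?a j) * p $ j / Z" for j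
    by (simp add: gibbs_def Z_def)
  show ?thesis
  proof (cases "\<forall>j. p $ j = 0 \<longrightarrow> l $ j = 0")
    case True
    have summand: "l $ j * ln (l $ j / gibbs \<nu> \<omega> p f h $ j)
        = l $ j * ln (l $ j / p $ j) + l $ j * ?a j + l $ j * ln Z" for j
    proof (cases "l $ j = 0")
      case False
      with True l p have "0 < l $ j" "0 < p $ j" by (auto simp: prob_simplex_def less_le)
      with Z show ?thesis
        by (simp add: gibbs ln_div ln_mult algebra_simps)
    qed simp
    have one: "(\<Sum>j\<in>UNIV. l $ j) = 1"
      using l by (simp add: prob_simplex_def)
    have "KL l (gibbs \<nu> \<omega> p f h)
        = ereal (\<Sum>j\<in>UNIV. l $ j * ln (l $ j / gibbs \<nu> \<omega> p f h $ j))"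
      using True Z by (intro KL_abs_cont) (simp add: gibbs)
    then have KL: "KL l (gibbs \<nu> \<omega> p f h) = ereal ((\<Sum>j\<in>UNIV. l $ j * ln (l $ j / p $ j))
        + \<nu> / (2 * \<omega>\<^sup>2) * (\<Sum>j\<in>UNIV. l $ j * (norm (f j - h))\<^sup>2) + ln Z)"
      unfolding summand
      by (simp add: sum.distrib one sum_distrib_left mult.left_commute flip: sum_distrib_right)
    have T: "T_fun \<nu> \<omega> p f Y h = - (\<nu> / (1 - \<nu>)) * (norm (h - Y))\<^sup>2 - 2 * \<omega>\<^sup>2 * ln Z"
      by (simp add: T_fun_def Z_def mult.commute)
    show ?thesis
      unfolding KL T S_fun_def using True \<open>0 < \<omega>\<close>
      by (simp add: KL_abs_cont field_simps)
  next
    case False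
    \<comment> \<open>\<open>gibbs\<close> vanishes wherever \<open>p\<close> does, so both
      divergences are infinite.\<close>
    then obtain i where "p $ i = 0" "l $ i \<noteq> 0" by auto
    then show ?thesis
      using \<open>0 < \<omega>\<close> by (simp add: S_fun_def gibbs KL_not_abs_cont[of _ i])
  qed
qed

section \<open>Existence of a point in both sets\<close>

lemma mem_A_inter_B_iff:
  "(l, h) \<in> A_set \<nu> f Y \<inter> B_set \<nu> \<omega> p f \<longleftrightarrow>
     l \<in> prob_simplex \<and> best_h \<nu> f Y l = h \<and> gibbs \<nu> \<omega> p f h = l"
  unfolding A_set_def B_set_def best_h_def gibbs_def vec_eq_iff
  by (auto simp: eq_commute)

lemma A_inter_B_nonempty:
  assumes "p \<in> prob_simplex"
  shows "\<exists>l h. (l, h) \<in> A_set \<nu> f Y \<inter> B_set \<nu> \<omega> p f"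
proof -
  let ?F = "\<lambda>l. gibbs \<nu> \<omega> p f (best_h \<nu> f Y l)"
  \<comment> \<open>A nonzero normaliser makes the division in \<open>?F\<close> continuous.\<close>
  have "(\<Sum>i\<in>UNIV. exp (- (\<nu> / (2 * \<omega>\<^sup>2)) * (norm (f i - h))\<^sup>2) * p $ i) \<noteq> 0" for h
    using prob_simplex_weighted_sum_pos[OF assms, of "\<lambda>i. exp (- (\<nu> / (2 * \<omega>\<^sup>2)) * (norm (f i - h))\<^sup>2)"]
    by simp
  then have "continuous_on prob_simplex ?F"
    unfolding gibbs_def best_h_def mixture_def
    by (intro continuous_intros) auto
  then obtain l where "l \<in> prob_simplex" "?F l = l"
    using brouwer[OF compact_prob_simplex convex_prob_simplex, of ?F] assms gibbs_in_prob_simplex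
    by blast
  then show ?thesis
    unfolding mem_A_inter_B_iff by blast
qed

section \<open>Attained extrema and the saddle point\<close>

lemma attains_max_imp_SUP:
  fixes g :: "'a \<Rightarrow> 'b::complete_linorder"
  assumes "attains_max g X v"
  shows "(SUP x\<in>X. g x) = v"
  using assms by (auto simp: attains_max_def intro!: antisym SUP_least intro: SUP_upper)

lemma attains_min_imp_INF:
  fixes g :: "'a \<Rightarrow> 'b::complete_linorder"
  assumes "attains_min g X v"
  shows "(INF x\<in>X. g x) = v"
  using assms by (auto simp: attains_min_def intro!: antisym INF_greatest intro: INF_lower)

theorem lemma2:
  fixes Y :: "real ^ 'n::finite"
    and f :: "'m::finite \<Rightarrow> real ^ 'n"
    and p :: "real ^ 'm"
    and \<nu> \<omega> :: real
  assumes "p \<in> prob_simplex" and "0 < \<nu>" and "\<nu> < 1" and "0 < \<omega>"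
  shows
    "(\<forall>l\<in>prob_simplex. attains_max (\<lambda>h. S_fun \<nu> \<omega> p f Y l h) UNIV (Q_fun \<nu> \<omega> p f Y l)) \<and>
     (\<forall>h. attains_min (\<lambda>l. S_fun \<nu> \<omega> p f Y l h) prob_simplex (ereal (T_fun \<nu> \<omega> p f Y h))) \<and>
     (\<exists>v::real.
        attains_min (Q_fun \<nu> \<omega> p f Y) prob_simplex (ereal v) \<and>
        attains_min (\<lambda>l. SUP h. S_fun \<nu> \<omega> p f Y l h) prob_simplex (ereal v) \<and>
        attains_max (\<lambda>h. INF l\<in>prob_simplex. S_fun \<nu> \<omega> p f Y l h) UNIV (ereal v) \<and>
        attains_max (T_fun \<nu> \<omega> p f Y) UNIV v \<and>
        (\<forall>lQ hhat.
           is_arg_min (Q_fun \<nu> \<omega> p f Y) (\<lambda>l. l \<in> prob_simplex) lQ \<longrightarrow>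
           is_arg_max (T_fun \<nu> \<omega> p f Y) (\<lambda>h. True) hhat \<longrightarrow>
             S_fun \<nu> \<omega> p f Y lQ hhat = ereal v \<and>
             {(lQ, hhat)} = A_set \<nu> f Y \<inter> B_set \<nu> \<omega> p f))"
proof -
  let ?Q = "Q_fun \<nu> \<omega> p f Y" and ?T = "T_fun \<nu> \<omega> p f Y" and ?S = "S_fun \<nu> \<omega> p f Y"
  let ?b = "best_h \<nu> f Y" and ?g = "gibbs \<nu> \<omega> p f"
  let ?c = "\<nu>\<^sup>2 / (1 - \<nu>)"
  note Q = Q_eq_S_plus_square[OF _ assms(2,3), where \<omega> = \<omega> and p = p and f = f and Y = Y]
  note S = S_eq_T_plus_KL[OF _ assms(1,4), where \<nu> = \<nu> and f = f and Y = Y]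
  note g = gibbs_in_prob_simplex[OF assms(1), of \<nu> \<omega> f]

  \<comment> \<open>The next facts give the sandwich \<open>?T h \<le> ?S l h \<le> ?Q l\<close>,
    with equality on the right at \<open>h = ?b l\<close> and on the left exactly at
    \<open>l = ?g h\<close>.\<close>
  have S_le_Q: "?S l h \<le> ?Q l" if "l \<in> prob_simplex" for l h
    unfolding Q[OF that, of h] using assms by (intro ereal_le_add_self) simp
  have S_best: "?S l (?b l) = ?Q l" if "l \<in> prob_simplex" for l
    unfolding Q[OF that, of "?b l"] by simp
  have T_le_S: "ereal (?T h) \<le> ?S l h" if "l \<in> prob_simplex" for l h
    unfolding S[OF that] using KL_nonneg_and_zero[OF that g]
    by (intro ereal_le_add_self) simp
  have S_gibbs: "?S (?g h) h = ereal (?T h)" for h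
    unfolding S[OF g] using KL_nonneg_and_zero[OF g g, of h h] by simp
  have S_eq_T: "l = ?g h" if "l \<in> prob_simplex" "?S l h = ereal (?T h)" for l h
  proof -
    \<comment> \<open>\<open>?T h\<close> is finite and can be cancelled.\<close>
    have "ereal (2 * \<omega>\<^sup>2) * KL l (?g h) = 0"
      using that(2) unfolding S[OF that(1)]
      by (cases "ereal (2 * \<omega>\<^sup>2) * KL l (?g h)") auto
    then have "KL l (?g h) = 0" using assms(4) by simp
    then show ?thesis using KL_nonneg_and_zero[OF that(1) g] by blast
  qed

  have max_S: "attains_max (\<lambda>h. ?S l h) UNIV (?Q l)" if "l \<in> prob_simplex" for l
    unfolding attains_max_def using S_le_Q[OF that] S_best[OF that] by blast
  have min_S: "attains_min (\<lambda>l. ?S l h) prob_simplex (ereal (?T h))" for h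
    unfolding attains_min_def using T_le_S S_gibbs g by blast
  note SUP_S = attains_max_imp_SUP[OF max_S]
  note INF_S = attains_min_imp_INF[OF min_S]

  obtain l0 h0 where AB: "(l0, h0) \<in> A_set \<nu> f Y \<inter> B_set \<nu> \<omega> p f"
    using A_inter_B_nonempty[OF assms(1)] by blast
  then have l0: "l0 \<in> prob_simplex" and h0: "?b l0 = h0" and l0_gibbs: "?g h0 = l0"
    unfolding mem_A_inter_B_iff by blast+
  define v where "v = ?T h0"
  \<comment> \<open>At a common point of \<open>A_set\<close> and \<open>B_set\<close> both
    inequalities are equalities, so \<open>?Q l0\<close> is finite too.\<close>
  have Q0: "?Q l0 = ereal v"
    using S_best[OF l0] S_gibbs[of h0] by (simp add: v_def h0 l0_gibbs)
  have Q_ge: "ereal v \<le> ?Q l" if "l \<in> prob_simplex" for l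
    using T_le_S[OF that, of h0] S_le_Q[OF that, of h0] v_def by simp
  have T_le: "?T h \<le> v" for h
    using T_le_S[OF l0, of h] S_le_Q[OF l0, of h] Q0
    by (metis ereal_less_eq(3) order_trans)
  have min_Q: "attains_min ?Q prob_simplex (ereal v)"
    unfolding attains_min_def using l0 Q0 Q_ge by blast
  have max_T: "attains_max ?T UNIV v"
    unfolding attains_max_def using T_le v_def by blast

  have uniq_l: "l = l0" if "l \<in> prob_simplex" "?Q l = ereal v" for l
  proof -
    \<comment> \<open>The sandwich at \<open>h0\<close> collapses, since both its ends equal
      \<open>v\<close>.\<close>
    have "?S l h0 = ereal (?T h0)"
      using T_le_S[OF that(1), of h0] S_le_Q[OF that(1), of h0] that(2) v_def by simp
    then show ?thesis using S_eq_T[OF that(1)] l0_gibbs by simp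
  qed
  have uniq_h: "h = h0" if "?T h = v" for h
  proof -
    \<comment> \<open>By the completed square, \<open>?S l0 h\<close> falls short of
      \<open>v\<close> by the quadratic term, yet it is at least \<open>?T h = v\<close>.\<close>
    have "ereal v + ereal (?c * (norm (h - h0))\<^sup>2) \<le> ereal v"
      using T_le_S[OF l0, of h] Q[OF l0, of h] Q0 that h0
      by (metis add_right_mono)
    then have "?c * (norm (h - h0))\<^sup>2 \<le> 0" by simp
    then show ?thesis using assms by (simp add: divide_le_0_iff mult_le_0_iff)
  qed
  have uniq_AB: "(l, h) = (l0, h0)" if "(l, h) \<in> A_set \<nu> f Y \<inter> B_set \<nu> \<omega> p f" for l h
  proof -
    from that have l: "l \<in> prob_simplex" and "?b l = h" "?g h = l"
      unfolding mem_A_inter_B_iff by blast+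
    then have "?Q l = ereal (?T h)"
      using S_best[OF l] S_gibbs[of h] by simp
    \<comment> \<open>Now \<open>v \<le> ?Q l = ?T h \<le> v\<close>, so both components are
      optimal.\<close>
    then have "ereal v \<le> ereal (?T h)" using Q_ge[OF l] by simp
    then have "?T h = v" using T_le[of h] by simp
    with \<open>?Q l = ereal (?T h)\<close> show ?thesis using uniq_l[OF l] uniq_h by simp
  qed

  have "attains_min (\<lambda>l. SUP h. ?S l h) prob_simplex (ereal v)"
    using min_Q SUP_S unfolding attains_min_def by simp
  moreover have "attains_max (\<lambda>h. INF l\<in>prob_simplex. ?S l h) UNIV (ereal v)"
    using max_T INF_S unfolding attains_max_def by simp
  moreover have "?S lQ hhat = ereal v \<and> {(lQ, hhat)} = A_set \<nu> f Y \<inter> B_set \<nu> \<omega> p f"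
    if "is_arg_min ?Q (\<lambda>l. l \<in> prob_simplex) lQ" "is_arg_max ?T (\<lambda>h. True) hhat" for lQ hhat
  proof -
    \<comment> \<open>\<open>is_arg_min\<close> only excludes strictly smaller values; comparison
      with \<open>l0\<close> turns this into an inequality.\<close>
    have "lQ \<in> prob_simplex" "?Q lQ \<le> ?Q l0"
      using that(1) l0 by (auto simp: is_arg_min_def not_less)
    then have "lQ = l0" using uniq_l Q_ge Q0 by (metis antisym)
    moreover have "v \<le> ?T hhat"
      using that(2) by (auto simp: is_arg_max_def not_less v_def)
    then have "hhat = h0" using uniq_h T_le by (metis antisym)
    moreover have "?S l0 h0 = ereal v" using S_best[OF l0] Q0 h0 by simp
    moreover have "A_set \<nu> f Y \<inter> B_set \<nu> \<omega> p f = {(l0, h0)}"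
      using AB uniq_AB by fast
    ultimately show ?thesis by simp
  qed
  ultimately show ?thesis
    using max_S min_S min_Q max_T by blast
qed

end
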